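(* Let $(x_n)_{n\ge1}$ be a sequence of real numbers and let $(\omega_{n,k})_{n\ge1,\,1\le k\le n}$ be a double array of real numbers with $\omega_{n,k}\ge0$ and $\sum_{k=1}^{n}\omega_{n,k}=1$ for every $n\ge1$, such that for every fixed $k\ge1$, $\lim_{n\to\infty}\omega_{n,k}=0$. Let $\bar x_n:=\sum_{k=1}^{n}\omega_{n,k}x_k$ be the ergodic sequence of $(x_k)$ with respect to $(\omega_{n,k})$. If $\lim_{n\to\infty}x_n=x$ for a real number $x$, then $$\lim_{n\to\infty}\bar x_n=x.$$ *)

theory Defs
  imports Complex_Main
begin

(* Sequences and weights are indexed from 1: only the values x k with k \<ge> 1 and
   w n k with 1 \<le> k \<le> n occur. *)

definition ergodic_seq :: "(nat \<Rightarrow> nat \<Rightarrow> real) \<Rightarrow> (nat \<Rightarrow> real) \<Rightarrow> nat \<Rightarrow> real" where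
  "ergodic_seq w x n = (\<Sum>k=1..n. w n k * x k)"

end

theory Submission
  imports Defs
begin

text \<open>Since the weights of row n sum to 1, the error of the weighted mean is itself a weighted
  mean, that of the deviations \<open>x k - l\<close>. Split it at a fixed index N beyond which all
  deviations are below e/2. The tail is then at most e/2 because the weights are nonnegative with
  total 1. The head has a fixed number of terms, each with a weight tending to 0, so it drops below
  e/2 for large n.\<close>

theorem proposition3:
  fixes x :: "nat \<Rightarrow> real" and \<omega> :: "nat \<Rightarrow> nat \<Rightarrow> real" and l :: real
  assumes nonneg: "\<And>n k. 1 \<le> n \<Longrightarrow> 1 \<le> k \<Longrightarrow> k \<le> n \<Longrightarrow> \<omega> n k \<ge> 0"
    and sum_one: "\<And>n. 1 \<le> n \<Longrightarrow> (\<Sum>k=1..n. \<omega> n k) = 1"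
    and column_limit: "\<And>k. 1 \<le> k \<Longrightarrow> (\<lambda>n. \<omega> n k) \<longlonglongrightarrow> 0"
    and lim: "x \<longlonglongrightarrow> l"
  shows "ergodic_seq \<omega> x \<longlonglongrightarrow> l"
proof (rule LIMSEQ_I)
  fix e :: real
  assume "e > 0"
  then obtain N where N: "\<And>k. k \<ge> N \<Longrightarrow> \<bar>x k - l\<bar> < e / 2"
    using LIMSEQ_D[OF lim, of "e / 2"] by auto
  \<comment> \<open>N is fixed before n grows, so this is a finite sum of null sequences and
    termwise limits suffice.\<close>
  have "(\<lambda>n. \<Sum>k=1..N. \<omega> n k * \<bar>x k - l\<bar>) \<longlonglongrightarrow> (\<Sum>k=1..N. 0 * \<bar>x k - l\<bar>)"
    by (intro tendsto_sum tendsto_mult column_limit tendsto_const) auto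
  then obtain M where M: "\<And>n. n \<ge> M \<Longrightarrow> (\<Sum>k=1..N. \<omega> n k * \<bar>x k - l\<bar>) < e / 2"
    using LIMSEQ_D[of _ 0 "e / 2"] \<open>e > 0\<close> by fastforce
  \<comment> \<open>\<open>Suc N\<close> rather than \<open>N\<close> guarantees n \<ge> 1 even when
    N = 0, so that \<open>sum_one\<close> applies; it also gives N \<le> n for the split.\<close>
  have "norm (ergodic_seq \<omega> x n - l) < e" if n: "n \<ge> max M (Suc N)" for n
  proof -
    have "ergodic_seq \<omega> x n - l = (\<Sum>k=1..n. \<omega> n k * x k) - (\<Sum>k=1..n. \<omega> n k) * l"
      using sum_one[of n] n by (simp add: ergodic_seq_def)
    also have "\<dots> = (\<Sum>k=1..n. \<omega> n k * (x k - l))"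
      by (simp add: sum_distrib_right sum_subtractf right_diff_distrib)
    finally have "\<bar>ergodic_seq \<omega> x n - l\<bar> \<le> (\<Sum>k=1..n. \<bar>\<omega> n k * (x k - l)\<bar>)"
      by simp
    also have "\<dots> = (\<Sum>k=1..n. \<omega> n k * \<bar>x k - l\<bar>)"
      using nonneg by (intro sum.cong) (auto simp: abs_mult)
    also have "\<dots> = (\<Sum>k=1..N. \<omega> n k * \<bar>x k - l\<bar>) + (\<Sum>k=Suc N..n. \<omega> n k * \<bar>x k - l\<bar>)"
      using n sum.ub_add_nat[of 1 N "\<lambda>k. \<omega> n k * \<bar>x k - l\<bar>" "n - N"] by simp
    \<comment> \<open>The head supplies the strict inequality; the tail may be empty or attain only
      a weak bound.\<close>
    also have "\<dots> < e / 2 + e / 2"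
    proof (rule add_less_le_mono)
      show "(\<Sum>k=1..N. \<omega> n k * \<bar>x k - l\<bar>) < e / 2"
        using M n by simp
      have "(\<Sum>k=Suc N..n. \<omega> n k * \<bar>x k - l\<bar>) \<le> (\<Sum>k=Suc N..n. \<omega> n k * (e / 2))"
        using nonneg N[THEN less_imp_le] by (intro sum_mono mult_left_mono) auto
      \<comment> \<open>Restoring the first N nonnegative terms completes the row, whose total
        weight is known.\<close>
      also have "\<dots> \<le> (\<Sum>k=1..n. \<omega> n k * (e / 2))"
        using nonneg \<open>e > 0\<close> by (intro sum_mono2) auto
      also have "\<dots> = e / 2"
        using sum_one[of n] n by (simp flip: sum_distrib_right sum_divide_distrib)
      finally show "(\<Sum>k=Suc N..n. \<omega> n k * \<bar>x k - l\<bar>) \<le> e / 2" .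
    qed
    finally show ?thesis by simp
  qed
  then show "\<exists>no. \<forall>n\<ge>no. norm (ergodic_seq \<omega> x n - l) < e"
    by blast
qed

end
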